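(* Let $\Gamma:[a,b]\to\mathbb{C}$ be an admissible path and let $\mathcal{F}$ denote the collection of all subpaths of $\Gamma$ and reverses of subpaths of $\Gamma$. Let $(M_n)_{n=0}^\infty$ be a sequence of positive real numbers such that $\sum_{n=1}^\infty M_n^{-1/n}=\infty$. Suppose that $f\in D_{\mathcal{F}}^{(\infty)}(\Gamma^* )$ and $z_0\in\Gamma^*$ satisfy $$\sup_{z\in\Gamma^*}|f^{[k]}(z)|\leq M_k\quad\text{and}\quad f^{[k]}(z_0)=0$$ for all integers $k\geq 0$. Then $f(z)=0$ for all $z\in\Gamma^*$.
   Context: A path in $\mathbb{C}$ is a continuous function $\gamma:[a,b]\to\mathbb{C}$ with $a<b$ real; its endpoints are $\gamma^-=\gamma(a)$ and $\gamma^+=\gamma(b)$, and its image is $\gamma^*=\gamma([a,b])$. A subpath of $\gamma$ is a restriction of $\gamma$ to a non-degenerate closed subinterval of $[a,b]$. The reverse of $\gamma$ is the path $-\gamma:[-b,-a]\to\mathbb{C}$, $t\mapsto\gamma(-t)$. A path is rectifiable if it has finite length (total variation), and admissible if it is rectifiable and has no constant subpaths. Integrals $\int_\gamma g(z)\,dz$ along rectifiable paths are the usual (Riemann--Stieltjes) path integrals. Let $X=\Gamma^*$. For $f\in C(X)$ (continuous complex-valued functions on $X$), a function $g\in C(X)$ is an $\mathcal{F}$-derivative of $f$ if $\int_\gamma g(z)\,dz=f(\gamma^+)-f(\gamma^-)$ for every $\gamma\in\mathcal{F}$. Such a $g$ is unique when it exists, and is denoted $f^{[1]}$. Let $D_{\mathcal{F}}^{(1)}(X)$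 be the set of all $f\in C(X)$ having an $\mathcal{F}$-derivative, and inductively $D_{\mathcal{F}}^{(n)}(X)=\{f\in D_{\mathcal{F}}^{(1)}(X): f^{[1]}\in D_{\mathcal{F}}^{(n-1)}(X)\}$ for $n\geq 2$; $f^{[n]}$ denotes the $n$th (iterated) $\mathcal{F}$-derivative and $f^{[0]}=f$. Let $D_{\mathcal{F}}^{(\infty)}(X)=\bigcap_{n\geq 1}D_{\mathcal{F}}^{(n)}(X)$. *)

theory Defs
  imports "HOL-Analysis.Analysis"
begin

text \<open>
  A triple \<open>(\<gamma>, a, b)\<close> stands for the restriction of \<open>\<gamma>\<close> to \<open>{a..b}\<close>; the values of \<open>\<gamma>\<close>
  elsewhere never matter. Parameter intervals are arbitrary, unlike for the library's
  \<^const>\<open>path\<close>, which is tied to \<open>{0..1}\<close>.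
\<close>

type_synonym cpath = "(real \<Rightarrow> complex) \<times> real \<times> real"

fun is_cpath :: "cpath \<Rightarrow> bool" where
  "is_cpath (\<gamma>, a, b) \<longleftrightarrow> a < b \<and> continuous_on {a..b} \<gamma>"

fun start_pt :: "cpath \<Rightarrow> complex" where
  "start_pt (\<gamma>, a, b) = \<gamma> a"

fun end_pt :: "cpath \<Rightarrow> complex" where
  "end_pt (\<gamma>, a, b) = \<gamma> b"

fun image_of :: "cpath \<Rightarrow> complex set" where
  "image_of (\<gamma>, a, b) = \<gamma> ` {a..b}"

fun subpaths :: "cpath \<Rightarrow> cpath set" where
  "subpaths (\<gamma>, a, b) = {(\<gamma>, c, d) | c d. a \<le> c \<and> c < d \<and> d \<le> b}"

fun reverse_cpath :: "cpath \<Rightarrow> cpath" where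
  "reverse_cpath (\<gamma>, a, b) = ((\<lambda>t. \<gamma> (- t)), - b, - a)"

fun is_constant :: "cpath \<Rightarrow> bool" where
  "is_constant (\<gamma>, a, b) \<longleftrightarrow> \<gamma> constant_on {a..b}"

text \<open>
  Members \<open>K\<close> of a division of \<open>{a..b}\<close> are nonempty compact intervals \<open>{Inf K..Sup K}\<close>.
\<close>

fun rectifiable :: "cpath \<Rightarrow> bool" where
  "rectifiable (\<gamma>, a, b) \<longleftrightarrow>
     (\<exists>L. \<forall>\<D>. \<D> division_of {a..b} \<longrightarrow> (\<Sum>K\<in>\<D>. norm (\<gamma> (Sup K) - \<gamma> (Inf K))) \<le> L)"

definition admissible :: "cpath \<Rightarrow> bool" where
  "admissible p \<longleftrightarrow> is_cpath p \<and> rectifiable p \<and> (\<forall>q\<in>subpaths p. \<not> is_constant q)"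

text \<open>
  The Riemann--Stieltjes integral of \<open>g \<circ> \<gamma>\<close> against \<open>d\<gamma>\<close>, as a limit of Riemann sums when the
  mesh tends to 0. The library's contour integral is of no use here, since it integrates against
  the derivative of \<open>\<gamma>\<close>, which need not determine a merely rectifiable path.
\<close>

fun has_path_integral :: "(complex \<Rightarrow> complex) \<Rightarrow> cpath \<Rightarrow> complex \<Rightarrow> bool" where
  "has_path_integral g (\<gamma>, a, b) I \<longleftrightarrow>
     (\<forall>\<epsilon>>0. \<exists>\<delta>>0. \<forall>\<D>. \<D> tagged_division_of {a..b} \<and> (\<forall>(t, K)\<in>\<D>. Sup K - Inf K < \<delta>) \<longrightarrow>
        norm ((\<Sum>(t, K)\<in>\<D>. g (\<gamma> t) * (\<gamma> (Sup K) - \<gamma> (Inf K))) - I) < \<epsilon>)"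

definition is_F_derivative ::
  "cpath set \<Rightarrow> complex set \<Rightarrow> (complex \<Rightarrow> complex) \<Rightarrow> (complex \<Rightarrow> complex) \<Rightarrow> bool" where
  "is_F_derivative F X f g \<longleftrightarrow>
     continuous_on X g \<and> (\<forall>\<gamma>\<in>F. has_path_integral g \<gamma> (f (end_pt \<gamma>) - f (start_pt \<gamma>)))"

text \<open>
  Elements of \<open>C(X)\<close> are represented by total functions of which only the values on \<open>X\<close> count.
  For the families \<open>F\<close> of interest the \<open>F\<close>-derivative is unique as a function on \<open>X\<close>, so the
  choice below only concerns its irrelevant values off \<open>X\<close>.
\<close>

definition F_deriv ::
  "cpath set \<Rightarrow> complex set \<Rightarrow> (complex \<Rightarrow> complex) \<Rightarrow> (complex \<Rightarrow> complex)" where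
  "F_deriv F X f = (SOME g. is_F_derivative F X f g)"

definition F_deriv_n ::
  "cpath set \<Rightarrow> complex set \<Rightarrow> nat \<Rightarrow> (complex \<Rightarrow> complex) \<Rightarrow> (complex \<Rightarrow> complex)" where
  "F_deriv_n F X n = (F_deriv F X ^^ n)"

text \<open>
  With \<open>D\<^sup>(\<^sup>0\<^sup>) = C(X)\<close> the recursion step at 0 yields exactly the functions in \<open>C(X)\<close> that have
  an \<open>F\<close>-derivative, because such a derivative is continuous on \<open>X\<close> by definition.
\<close>

primrec D_space :: "cpath set \<Rightarrow> complex set \<Rightarrow> nat \<Rightarrow> (complex \<Rightarrow> complex) set" where
  "D_space F X 0 = {f. continuous_on X f}"
| "D_space F X (Suc n) =
     {f. continuous_on X f \<and> (\<exists>g. is_F_derivative F X f g) \<and> F_deriv F X f \<in> D_space F X n}"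

definition D_infinity :: "cpath set \<Rightarrow> complex set \<Rightarrow> (complex \<Rightarrow> complex) set" where
  "D_infinity F X = (\<Inter>n\<in>{1..}. D_space F X n)"

end

theory Submission
  imports Defs
begin

text \<open>
  This is Bang's real-variable argument, which needs no Taylor formula and no regularity of
  \<open>M\<close>. Let \<open>s\<close> be the arc length and \<open>g\<^sub>n = f\<^sup>[\<^sup>n\<^sup>] \<circ> \<Gamma>\<close>, so that \<open>g\<^sub>n\<close> varies by at most
  \<open>\<Delta>s \<cdot> sup \<bar>g\<^sub>n\<^sub>+\<^sub>1\<bar>\<close>. Start where all \<open>g\<^sub>n\<close> vanish and suppose that \<open>g\<^sub>0\<close> is nonzero at the other
  end; lower \<open>M\<^sub>0\<close> to its absolute value there. Suppose \<open>c \<mu>\<^sup>j \<le> M\<^sub>j\<close> for \<open>j \<le> k\<close>, with equality for \<open>j = k\<close>.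
  Between the first times at which some \<open>\<bar>g\<^sub>n\<bar>\<close> with \<open>n \<le> k\<close> reaches \<open>v (2\<mu>)\<^sup>n c\<close> and
  \<open>2 v (2\<mu>)\<^sup>n c\<close>, respectively, arc length at least \<open>1 / (4\<mu>)\<close> passes as long as \<open>v \<ge> 2\<^sup>-\<^sup>k\<close>. Choosing the
  tangent \<open>c \<mu>\<^sup>j\<close> that touches \<open>M\<close> at \<open>k\<close> and at some \<open>k' < k\<close>, one descends from level
  \<open>2\<^sup>-\<^sup>k\<^sup>'\<close> to \<open>2\<^sup>-\<^sup>k\<close> and repeats. The slopes met on the way are those of the logarithmically convex
  minorant of \<open>M\<^sub>0, \<dots>, M\<^sub>k\<close>, so their reciprocals sum to at most four times the arc length, and
  Carleman's inequality bounds \<open>\<Sum>\<^sub>n\<^sub>\<le>\<^sub>k (M\<^sub>0 / M\<^sub>n)\<^sup>1\<^sup>/\<^sup>n\<close> independently of \<open>k\<close>.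
\<close>

section \<open>Carleman's inequality\<close>

text \<open>AM-GM: \<open>1 + y \<le> exp y\<close> is applied to \<open>y = x i / A - 1\<close>,
  and these exponents sum to 0.\<close>

lemma prod_le_mean_power:
  fixes x :: "nat \<Rightarrow> real"
  assumes n: "n > 0" and x: "\<And>i. i < n \<Longrightarrow> x i > 0"
  shows "(\<Prod>i<n. x i) \<le> ((\<Sum>i<n. x i) / n) ^ n"
proof -
  define A where "A = (\<Sum>i<n. x i) / n"
  have "(\<Sum>i<n. x i) > 0"
    using n x by (intro sum_pos) auto
  then have A: "A > 0" using n by (simp add: A_def)
  have "(\<Prod>i<n. x i / A) \<le> (\<Prod>i<n. exp (x i / A - 1))"
  proof (rule prod_mono)
    fix i assume "i \<in> {..<n}"
    then show "0 \<le> x i / A \<and> x i / A \<le> exp (x i / A - 1)"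
      using x[of i] A exp_ge_add_one_self[of "x i / A - 1"] by simp
  qed
  also have "\<dots> = exp ((\<Sum>i<n. x i) / A - n)"
    by (simp add: exp_sum[symmetric] sum_subtractf sum_divide_distrib)
  also have "(\<Sum>i<n. x i) / A = n"
    using A n by (simp add: A_def field_simps)
  finally have "(\<Prod>i<n. x i / A) \<le> 1" by simp
  then show ?thesis
    using A by (simp add: prod_dividef A_def[symmetric] field_simps)
qed

text \<open>\<open>n ^ n / fact n\<close> is a single term of the exponential series at
  \<open>n\<close>.\<close>

lemma power_self_le_exp_fact: "real n ^ n \<le> exp (real n) * fact n"
proof -
  have "(\<Sum>k\<in>{n}. real n ^ k /\<^sub>R fact k) \<le> exp (real n)"
    unfolding exp_def by (rule sum_le_suminf) (auto simp: summable_exp)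
  then show ?thesis by (simp add: field_simps)
qed

text \<open>AM-GM for the weighted terms \<open>Suc i * a i\<close>: the weights multiply to
  \<open>fact n\<close>, which is at least \<open>(n / exp 1) ^ n\<close>.\<close>

lemma carleman_term_le:
  fixes a :: "nat \<Rightarrow> real"
  assumes n: "n > 0" and a: "\<And>i. i < n \<Longrightarrow> a i > 0"
  shows "(\<Prod>i<n. a i) powr (1 / n) \<le> exp 1 * ((\<Sum>i<n. Suc i * a i) / (real n)\<^sup>2)"
proof -
  define S where "S = (\<Sum>i<n. Suc i * a i)"
  define Q where "Q = exp 1 * (S / (real n)\<^sup>2)"
  have P: "(\<Prod>i<n. a i) > 0" using a by (intro prod_pos) auto
  have "S > 0" unfolding S_def using n a by (intro sum_pos) auto
  then have Q: "Q > 0" using n by (simp add: Q_def)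
  have "(\<Prod>i<n. Suc i * a i) \<le> (S / n) ^ n"
    unfolding S_def using n a by (intro prod_le_mean_power) auto
  moreover have "(\<Prod>i<n. real (Suc i) * a i) = fact n * (\<Prod>i<n. a i)"
    by (simp add: prod.distrib fact_prod_Suc lessThan_atLeast0)
  ultimately have *: "fact n * (\<Prod>i<n. a i) \<le> (S / n) ^ n" by simp
  have "real n ^ n * (\<Prod>i<n. a i) \<le> exp (real n) * fact n * (\<Prod>i<n. a i)"
    using power_self_le_exp_fact[of n] P by (intro mult_right_mono) auto
  also have "\<dots> \<le> exp (real n) * (S / n) ^ n"
    using * by (simp add: mult.assoc)
  also have "\<dots> = real n ^ n * Q ^ n"
    using n by (simp add: Q_def power_mult_distrib[symmetric] exp_of_nat_mult[of _ 1, simplified] power2_eq_square)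
  finally have "(\<Prod>i<n. a i) \<le> Q ^ n" using n by simp
  then have "(\<Prod>i<n. a i) powr (1 / n) \<le> (Q ^ n) powr (1 / n)"
    using P by (intro powr_mono2) auto
  also have "\<dots> = Q" using Q n by (simp add: powr_realpow[symmetric] powr_powr)
  finally show ?thesis by (simp add: Q_def S_def)
qed

lemma sum_weighted_means_le:
  fixes a :: "nat \<Rightarrow> real"
  assumes a: "\<And>i. a i > 0"
  shows "(\<Sum>n=1..k. (\<Sum>i<n. Suc i * a i) / (real n)\<^sup>2) \<le> 2 * (\<Sum>i<k. a i)"
proof -
  define S where "S n = (\<Sum>i<n. Suc i * a i)" for n
  have S: "S n \<ge> 0" for n
    unfolding S_def using a by (intro sum_nonneg) (simp add: less_imp_le)
  \<comment> \<open>The correction \<open>S k / Suc k\<close> lets the induction close: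
    \<open>1 / K^2\<close> is at most \<open>2 * (1 / K - 1 / (K + 1))\<close>, a telescoping
    weight.\<close>
  have "(\<Sum>n=1..k. S n / (real n)\<^sup>2) \<le> 2 * ((\<Sum>i<k. a i) - S k / Suc k)"
  proof (induction k)
    case 0
    show ?case by (simp add: S_def)
  next
    case (Suc k)
    define K where "K = real (Suc k)"
    have K: "K \<ge> 1" by (simp add: K_def)
    have "S (Suc k) / K\<^sup>2 = S (Suc k) / K * (1 / K)" by (simp add: power2_eq_square)
    also have "\<dots> \<le> S (Suc k) / K * (2 / (K + 1))"
      using S[of "Suc k"] K by (intro mult_left_mono) (auto simp: field_simps)
    also have "\<dots> = 2 * (S (Suc k) / K - S (Suc k) / (K + 1))"
      using K by (simp add: field_simps)
    also have "S (Suc k) / K = S k / K + a k"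
      using K by (simp add: S_def K_def add_divide_distrib)
    finally show ?case using Suc by (simp add: K_def algebra_simps)
  qed
  also have "\<dots> \<le> 2 * (\<Sum>i<k. a i)" using S by simp
  finally show ?thesis unfolding S_def .
qed

lemma carleman_inequality:
  fixes a :: "nat \<Rightarrow> real"
  assumes a: "\<And>i. a i > 0"
  shows "(\<Sum>n=1..k. (\<Prod>i<n. a i) powr (1 / n)) \<le> 2 * exp 1 * (\<Sum>i<k. a i)"
proof -
  have "(\<Sum>n=1..k. (\<Prod>i<n. a i) powr (1 / n))
      \<le> (\<Sum>n=1..k. exp 1 * ((\<Sum>i<n. Suc i * a i) / (real n)\<^sup>2))"
    using a by (intro sum_mono carleman_term_le) auto
  also have "\<dots> \<le> exp 1 * (2 * (\<Sum>i<k. a i))"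
    unfolding sum_distrib_left[symmetric] using sum_weighted_means_le[OF a]
    by (intro mult_left_mono) auto
  finally show ?thesis by simp
qed

section \<open>Bang's argument\<close>

text \<open>On a logarithmic scale \<open>c * \<mu> ^ j\<close> is a line. Among the chords from
  earlier points of the graph of \<open>M\<close> to its point at \<open>k\<close>, the steepest one
  stays below the graph up to \<open>k\<close>.\<close>

lemma tangent_exists:
  fixes M :: "nat \<Rightarrow> real"
  assumes M: "\<And>n. M n > 0" and k: "k > 0"
  obtains k' c \<mu> where "k' < k" "c > 0" "\<mu> > 0" "M k = c * \<mu> ^ k" "M k' = c * \<mu> ^ k'"
    "\<forall>j\<le>k. c * \<mu> ^ j \<le> M j"
proof -
  \<comment> \<open>For \<open>j < k\<close>, \<open>r j\<close> is the exponential of the slope of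
    the chord from \<open>j\<close> to \<open>k\<close>.\<close>
  define r where "r j = (M k / M j) powr (1 / (k - j))" for j
  have r: "r j > 0" for j
    using M[of k] M[of j] by (simp add: r_def)
  have rk: "r j ^ (k - j) = M k / M j" if "j < k" for j
    using that M[of k] M[of j] by (simp add: r_def powr_realpow[symmetric] powr_powr)
  obtain k' where k': "k' < k" and max: "\<And>j. j < k \<Longrightarrow> r j \<le> r k'"
  proof -
    have "Max (r ` {..<k}) \<in> r ` {..<k}" using k by (intro Max_in) auto
    then obtain k' where "k' < k" "r k' = Max (r ` {..<k})" by auto
    then show ?thesis by (intro that[of k']) auto
  qed
  define \<mu> where "\<mu> = r k'"
  define c where "c = M k / \<mu> ^ k"
  have \<mu>: "\<mu> > 0" and c: "c > 0" using r M by (auto simp: \<mu>_def c_def)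
  have split: "\<mu> ^ k = \<mu> ^ j * \<mu> ^ (k - j)" if "j \<le> k" for j
    using that by (simp add: power_add[symmetric])
  show ?thesis
  proof
    show "k' < k" "c > 0" "\<mu> > 0" by fact+
    show Mk: "M k = c * \<mu> ^ k" using \<mu> by (simp add: c_def)
    have "\<mu> ^ (k - k') = M k / M k'" using rk[OF k'] by (simp add: \<mu>_def)
    then show "M k' = c * \<mu> ^ k'"
      using Mk split[of k'] k' M[of k'] \<mu> c by (simp add: field_simps)
    show "\<forall>j\<le>k. c * \<mu> ^ j \<le> M j"
    proof (intro allI impI)
      fix j assume "j \<le> k"
      show "c * \<mu> ^ j \<le> M j"
      proof (cases "j = k")
        case True then show ?thesis using Mk by simp
      next
        case False
        then have j: "j < k" using \<open>j \<le> k\<close> by simp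
        have "M k / M j \<le> \<mu> ^ (k - j)"
          using rk[OF j] max[OF j] r[of j] by (metis \<mu>_def less_imp_le power_mono)
        then have "M k \<le> M j * \<mu> ^ (k - j)" using M[of j] by (simp add: field_simps)
        then have "c * \<mu> ^ j * \<mu> ^ (k - j) \<le> M j * \<mu> ^ (k - j)"
          using Mk split[of j] j by (simp add: mult.assoc)
        then show ?thesis using \<mu> by simp
      qed
    qed
  qed
qed

text \<open>A mean value inequality in terms of \<open>s\<close> replaces differentiability. The
  interval is general so that both sides of a common zero can be treated, the left one after a
  reflection.\<close>

locale flat_chain =
  fixes g :: "nat \<Rightarrow> real \<Rightarrow> 'a::real_normed_vector" and s :: "real \<Rightarrow> real" and a b :: real
  assumes continuous: "\<And>n. continuous_on {a..b} (g n)"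
    and mono: "\<And>c d. a \<le> c \<Longrightarrow> c \<le> d \<Longrightarrow> d \<le> b \<Longrightarrow> s c \<le> s d"
    and increment: "\<And>n c d B. a \<le> c \<Longrightarrow> c \<le> d \<Longrightarrow> d \<le> b \<Longrightarrow>
          (\<And>t. c \<le> t \<Longrightarrow> t \<le> d \<Longrightarrow> norm (g (Suc n) t) \<le> B) \<Longrightarrow>
          norm (g n d - g n c) \<le> B * (s d - s c)"
    and flat: "\<And>n. g n a = 0"
begin

section \<open>First passage times and the cost of halving a level\<close>

text \<open>Finitely many indices give a closed set of hitting times, so a least one exists.\<close>

lemma first_hit:
  assumes v: "\<And>n. v n > 0" and t: "a \<le> t" "t \<le> b"
    and hit: "\<exists>n\<le>k. v n \<le> norm (g n t)"
  obtains \<tau> where "a \<le> \<tau>" "\<tau> \<le> t" "\<exists>n\<le>k. v n \<le> norm (g n \<tau>)"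
    "\<forall>n\<le>k. \<forall>u\<in>{a..\<tau>}. norm (g n u) \<le> v n"
proof -
  define E where "E = (\<Union>n\<in>{..k}. {u \<in> {a..t}. v n \<le> norm (g n u)})"
  have cont: "continuous_on {a..t} (\<lambda>u. norm (g n u))" for n
    using t by (intro continuous_on_norm continuous_on_subset[OF continuous]) auto
  have "closed E"
    unfolding E_def
    by (intro closed_UN finite_atMost ballI continuous_on_closed_Collect_le
        continuous_on_const cont closed_atLeastAtMost)
  have bdd: "bdd_below E" unfolding E_def by (intro bdd_belowI[of _ a]) auto
  have ne: "E \<noteq> {}" using hit t by (auto simp: E_def)
  have \<tau>: "Inf E \<in> E" using closed_contains_Inf[OF ne bdd \<open>closed E\<close>] .
  show ?thesis
  proof (rule that[of "Inf E"])
    show "a \<le> Inf E" "Inf E \<le> t" "\<exists>n\<le>k. v n \<le> norm (g n (Inf E))"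
      using \<tau> by (auto simp: E_def)
    show "\<forall>n\<le>k. \<forall>u\<in>{a..Inf E}. norm (g n u) \<le> v n"
    proof (intro allI impI ballI, rule ccontr)
      fix n u assume n: "n \<le> k" and "u \<in> {a..Inf E}"
      then have u: "a \<le> u" "u \<le> Inf E" by auto
      assume "\<not> norm (g n u) \<le> v n"
      then have gt: "v n < norm (g n u)" by simp
      have "continuous_on {a..u} (\<lambda>u. norm (g n u))"
        using u \<open>Inf E \<le> t\<close> by (intro continuous_on_subset[OF cont]) auto
      \<comment> \<open>Every \<open>g n\<close> starts at 0, so exceeding \<open>v n\<close> at
        \<open>u\<close> forces equality at some earlier \<open>w\<close>. As \<open>w\<close> is
        itself a hitting time, it cannot precede \<open>Inf E\<close>.\<close>
      then obtain w where w: "a \<le> w" "w \<le> u" "norm (g n w) = v n"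
        using IVT'[of "\<lambda>u. norm (g n u)" a "v n" u] gt v[of n] u by (auto simp: flat)
      then have "w \<in> E" using n u \<open>Inf E \<le> t\<close> unfolding E_def by (intro UN_I[of n]) auto
      then have "Inf E \<le> w" using bdd by (rule cInf_lower)
      then show False using w u gt by (metis order.antisym order.trans less_irrefl)
    qed
  qed
qed

text \<open>Let \<open>q\<close> be the first time for the doubled thresholds and \<open>p\<close>
  the first time for the plain ones. The function that hits at \<open>q\<close> gains at least its
  plain threshold between them, at a bounded rate in \<open>s\<close>.\<close>

lemma halving:
  assumes pos: "v > 0" "c > 0" "\<mu> > 0"
    and top: "\<forall>u\<in>{a..b}. norm (g k u) \<le> v * (2 * \<mu>) ^ k * c"
    and t: "a \<le> t" "t \<le> b"
    and hit: "\<exists>n\<le>k. 2 * v * (2 * \<mu>) ^ n * c \<le> norm (g n t)"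
  obtains u where "a \<le> u" "u \<le> t" "\<exists>n\<le>k. v * (2 * \<mu>) ^ n * c \<le> norm (g n u)"
    "1 / (4 * \<mu>) \<le> s t - s u"
proof -
  define w where "w n = v * (2 * \<mu>) ^ n * c" for n
  have w: "w n > 0" for n using pos by (simp add: w_def)
  then have w2: "2 * w n > 0" for n by simp
  have hit2: "\<exists>n\<le>k. 2 * w n \<le> norm (g n t)"
    using hit by (simp add: w_def mult.assoc)
  obtain q where q: "a \<le> q" "q \<le> t" "\<exists>n\<le>k. 2 * w n \<le> norm (g n q)"
      "\<forall>n\<le>k. \<forall>u\<in>{a..q}. norm (g n u) \<le> 2 * w n"
    using first_hit[OF w2 t hit2] by metis
  have hit1: "\<exists>n\<le>k. w n \<le> norm (g n q)"
  proof -
    obtain n where "n \<le> k" "2 * w n \<le> norm (g n q)" using q(3) by auto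
    then show ?thesis using w[of n] by (intro exI[of _ n]) auto
  qed
  have qb: "q \<le> b" using q t by simp
  obtain p where p: "a \<le> p" "p \<le> q" "\<exists>n\<le>k. w n \<le> norm (g n p)"
      "\<forall>n\<le>k. \<forall>u\<in>{a..p}. norm (g n u) \<le> w n"
    using first_hit[OF w q(1) qb hit1] by metis
  obtain n where n: "n \<le> k" "2 * w n \<le> norm (g n q)" using q by auto
  \<comment> \<open>The cap \<open>top\<close> excludes the index \<open>k\<close>, so the next
    function \<open>g (Suc n)\<close> still has a threshold.\<close>
  have "n \<noteq> k"
    using bspec[OF top, of q] q t n w[of k] by (auto simp: w_def)
  then have nk: "Suc n \<le> k" using n by simp
  have "w n \<le> norm (g n q) - norm (g n p)"
    using n p(1) bspec[OF mp[OF spec[OF p(4), of n] n(1)], of p] by simp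
  also have "\<dots> \<le> norm (g n q - g n p)" by (rule norm_triangle_ineq2)
  \<comment> \<open>Before \<open>q\<close> no doubled threshold is exceeded, and
    \<open>2 * w (Suc n)\<close> equals \<open>4 * \<mu> * w n\<close>.\<close>
  also have "\<dots> \<le> 2 * w (Suc n) * (s q - s p)"
    using p q t nk by (intro increment) auto
  also have "\<dots> = w n * (4 * \<mu> * (s q - s p))"
    by (simp add: w_def)
  finally have "1 \<le> 4 * \<mu> * (s q - s p)" using w[of n] by simp
  then have "1 / (4 * \<mu>) \<le> s q - s p" using pos by (simp add: field_simps)
  moreover have "s q \<le> s t" using mono q t by auto
  ultimately show ?thesis
    using p q by (intro that[of p]) (auto simp: w_def)
qed

lemma iterated_halving:
  assumes pos: "v > 0" "c > 0" "\<mu> > 0"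
    and top: "\<forall>u\<in>{a..b}. norm (g k u) \<le> v * (2 * \<mu>) ^ k * c"
    and t: "a \<le> t" "t \<le> b"
    and hit: "\<exists>n\<le>k. 2 ^ m * v * (2 * \<mu>) ^ n * c \<le> norm (g n t)"
  shows "\<exists>u. a \<le> u \<and> u \<le> t \<and> (\<exists>n\<le>k. v * (2 * \<mu>) ^ n * c \<le> norm (g n u))
    \<and> m / (4 * \<mu>) \<le> s t - s u"
  using t hit
proof (induction m arbitrary: t)
  case 0
  then show ?case by auto
next
  case (Suc m)
  \<comment> \<open>The cap at the lowest level \<open>v\<close> implies the caps at all higher
    levels passed on the way.\<close>
  have "v * (2 * \<mu>) ^ k * c \<le> 2 ^ m * v * (2 * \<mu>) ^ k * c"
    using pos by simp
  then have top': "\<forall>u\<in>{a..b}. norm (g k u) \<le> 2 ^ m * v * (2 * \<mu>) ^ k * c"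
    using top by (meson order.trans)
  have hit': "\<exists>n\<le>k. 2 * (2 ^ m * v) * (2 * \<mu>) ^ n * c \<le> norm (g n t)"
    using Suc.prems(3) by (simp add: mult.assoc)
  have pos': "2 ^ m * v > 0" using pos by simp
  obtain u where u: "a \<le> u" "u \<le> t" "\<exists>n\<le>k. 2 ^ m * v * (2 * \<mu>) ^ n * c \<le> norm (g n u)"
    "1 / (4 * \<mu>) \<le> s t - s u"
    using halving[OF pos' pos(2,3) top' Suc.prems(1,2) hit'] by metis
  then obtain u' where u': "a \<le> u'" "u' \<le> u" "\<exists>n\<le>k. v * (2 * \<mu>) ^ n * c \<le> norm (g n u')"
    "m / (4 * \<mu>) \<le> s u - s u'"
    using Suc.IH[of u] Suc.prems by auto
  have "Suc m / (4 * \<mu>) = 1 / (4 * \<mu>) + m / (4 * \<mu>)"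
    by (simp add: add_divide_distrib)
  with u u' show ?case by (intro exI[of _ u']) auto
qed

text \<open>
  The \<open>x i\<close> are the reciprocal slopes of the minorant. The level condition refers to an arbitrary
  supporting line, as the induction step replaces it by the tangent, which lies above it.
\<close>

lemma descent:
  fixes M :: "nat \<Rightarrow> real" and k :: nat
  assumes M: "\<And>n. M n > 0" and bound: "\<forall>n>0. \<forall>u\<in>{a..b}. norm (g n u) \<le> M n"
    and start: "M 0 \<le> norm (g 0 b)" and ab: "a \<le> b"
    and line: "c > 0" "\<mu> > 0" "M k = c * \<mu> ^ k" "\<forall>j\<le>k. c * \<mu> ^ j \<le> M j"
  shows "\<exists>x t. (\<forall>i. x i > 0) \<and> (\<Prod>i<k. x i) = M 0 / M k \<and> (\<forall>j\<le>k. M 0 / M j \<le> (\<Prod>i<j. x i))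
    \<and> a \<le> t \<and> t \<le> b \<and> (\<exists>n\<le>k. (1 / 2) ^ k * (2 * \<mu>) ^ n * c \<le> norm (g n t))
    \<and> (\<Sum>i<k. x i) \<le> 4 * (s b - s t)"
  using line
proof (induction k arbitrary: c \<mu> rule: less_induct)
  case (less k)
  show ?case
  proof (cases "k = 0")
    case True
    \<comment> \<open>For \<open>k = 0\<close> the level is 1 and \<open>c = M 0\<close>, so
      \<open>b\<close> itself is a hitting time; the empty product and sum cost no length.\<close>
    then show ?thesis
      using less.prems start ab M[of 0]
      by (intro exI[of _ "\<lambda>_. 1"] exI[of _ b]) auto
  next
    case False
    \<comment> \<open>The tangent at \<open>k\<close> also passes through the point at
      \<open>k'\<close>, so it is a valid supporting line for the induction hypothesis
      there.\<close>
    then obtain k' c0 \<mu>0 where k': "k' < k" and pos: "c0 > 0" "\<mu>0 > 0"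
      and Mk: "M k = c0 * \<mu>0 ^ k" and Mk': "M k' = c0 * \<mu>0 ^ k'"
      and below: "\<forall>j\<le>k. c0 * \<mu>0 ^ j \<le> M j"
      using tangent_exists[of M k] M by (metis gr0I)
    have below': "\<forall>j\<le>k'. c0 * \<mu>0 ^ j \<le> M j" using below k' by simp
    obtain x t where x: "\<And>i. x i > 0" "(\<Prod>i<k'. x i) = M 0 / M k'"
        "\<And>j. j \<le> k' \<Longrightarrow> M 0 / M j \<le> (\<Prod>i<j. x i)"
      and t: "a \<le> t" "t \<le> b" "\<exists>n\<le>k'. (1 / 2) ^ k' * (2 * \<mu>0) ^ n * c0 \<le> norm (g n t)"
      and sum: "(\<Sum>i<k'. x i) \<le> 4 * (s b - s t)"
      using less.IH[OF k' pos Mk' below'] by metis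
    \<comment> \<open>From level \<open>(1 / 2) ^ k'\<close> exactly \<open>k - k'\<close> halvings
      lead to level \<open>(1 / 2) ^ k\<close>.\<close>
    have half: "2 ^ (k - k') * (1 / 2) ^ k = (1 / 2 :: real) ^ k'"
    proof -
      have "(1 / 2 :: real) ^ k = (1 / 2) ^ (k - k') * (1 / 2) ^ k'"
        using k' by (simp only: power_add[symmetric]) simp
      moreover have "2 ^ (k - k') * (1 / 2 :: real) ^ (k - k') = 1"
        by (simp only: power_mult_distrib[symmetric]) simp
      ultimately show ?thesis by (metis mult.assoc mult_1)
    qed
    \<comment> \<open>At the final level the threshold for index \<open>k\<close> is exactly
      \<open>M k\<close>, so \<open>bound\<close> supplies the cap.\<close>
    have topk: "(1 / 2) ^ k * (2 * \<mu>0) ^ k * c0 = M k"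
      by (simp only: Mk power_mult_distrib[symmetric]) simp
    have "\<exists>n\<le>k. 2 ^ (k - k') * (1 / 2) ^ k * (2 * \<mu>0) ^ n * c0 \<le> norm (g n t)"
      unfolding half using t(3) k' by (meson less_imp_le order.trans)
    then obtain u where u: "a \<le> u" "u \<le> t"
        "\<exists>n\<le>k. (1 / 2) ^ k * (2 * \<mu>0) ^ n * c0 \<le> norm (g n u)"
        "(k - k') / (4 * \<mu>0) \<le> s t - s u"
      using iterated_halving[of "(1 / 2) ^ k" c0 \<mu>0 k t "k - k'"] pos t(1,2) bound False topk
      by auto
    \<comment> \<open>Both lines meet at \<open>k\<close>, and the given one is not above the
      tangent at \<open>k'\<close>; hence it is at least as steep and lies below the tangent up to
      \<open>k\<close>.\<close>
    have "c * \<mu> ^ k' * \<mu>0 ^ (k - k') \<le> c * \<mu> ^ k' * \<mu> ^ (k - k')"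
    proof -
      have "c * \<mu> ^ k' * \<mu>0 ^ (k - k') \<le> M k' * \<mu>0 ^ (k - k')"
        using spec[OF less.prems(4), of k'] k' pos by (intro mult_right_mono) auto
      also have "\<dots> = M k" using k' by (simp add: Mk Mk' power_add[symmetric] mult.assoc)
      also have "\<dots> = c * \<mu> ^ k' * \<mu> ^ (k - k')"
        using k' less.prems(3) by (simp add: power_add[symmetric] mult.assoc)
      finally show ?thesis .
    qed
    then have "\<mu>0 ^ (k - k') \<le> \<mu> ^ (k - k')" using less.prems by simp
    then have \<mu>: "\<mu>0 \<le> \<mu>" using k' less.prems pos by (simp add: power_mono_iff)
    have lines: "c * \<mu> ^ n \<le> c0 * \<mu>0 ^ n" if "n \<le> k" for n
    proof -
      have "c * \<mu> ^ n * \<mu>0 ^ (k - n) \<le> c * \<mu> ^ n * \<mu> ^ (k - n)"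
        using \<mu> less.prems pos by (intro mult_left_mono power_mono) auto
      also have "\<dots> = M k" using that less.prems(3) by (simp add: power_add[symmetric] mult.assoc)
      also have "\<dots> = c0 * \<mu>0 ^ n * \<mu>0 ^ (k - n)"
        using that by (simp add: Mk power_add[symmetric] mult.assoc)
      finally show ?thesis using pos by simp
    qed
    have hit: "\<exists>n\<le>k. (1 / 2) ^ k * (2 * \<mu>) ^ n * c \<le> norm (g n u)"
    proof -
      obtain n where n: "n \<le> k" "(1 / 2) ^ k * (2 * \<mu>0) ^ n * c0 \<le> norm (g n u)"
        using u by auto
      have "(1 / 2) ^ k * 2 ^ n * (c * \<mu> ^ n) \<le> (1 / 2) ^ k * 2 ^ n * (c0 * \<mu>0 ^ n)"
        using lines[OF n(1)] by (intro mult_left_mono) auto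
      then have "(1 / 2) ^ k * (2 * \<mu>) ^ n * c \<le> (1 / 2) ^ k * (2 * \<mu>0) ^ n * c0"
        by (simp only: power_mult_distrib ac_simps)
      with n show ?thesis by (meson order.trans)
    qed
    \<comment> \<open>Each of the \<open>k - k'\<close> halvings costs length at least
      \<open>1 / (4 * \<mu>0)\<close> and contributes one reciprocal slope
      \<open>1 / \<mu>0\<close>. From \<open>k'\<close> to \<open>k\<close> the partial products of
      \<open>y\<close> are then \<open>M 0\<close> over the values of the tangent.\<close>
    define y where "y i = (if i < k' then x i else 1 / \<mu>0)" for i
    have prod_y: "(\<Prod>i<j. y i) = (\<Prod>i<k'. x i) / \<mu>0 ^ (j - k')" if "k' \<le> j" for j
    proof -
      have "(\<Prod>i<j. y i) = (\<Prod>i<k'. y i) * (\<Prod>i\<in>{k'..<j}. y i)"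
        using that by (subst prod.union_disjoint[symmetric]) (auto intro!: prod.cong)
      then show ?thesis by (simp add: y_def power_divide field_simps)
    qed
    have sum_y: "(\<Sum>i<k. y i) = (\<Sum>i<k'. x i) + (k - k') / \<mu>0"
    proof -
      have "(\<Sum>i<k. y i) = (\<Sum>i<k'. y i) + (\<Sum>i\<in>{k'..<k}. y i)"
        using k' by (subst sum.union_disjoint[symmetric]) (auto intro!: sum.cong)
      then show ?thesis by (simp add: y_def)
    qed
    have prod_line: "(\<Prod>i<k'. x i) / \<mu>0 ^ (j - k') = M 0 / (c0 * \<mu>0 ^ j)" if "k' \<le> j" for j
      using that pos by (simp add: x(2) Mk' power_add[symmetric] mult.assoc)
    show ?thesis
    proof (intro exI[of _ y] exI[of _ u] conjI allI impI)
      show "y i > 0" for i using x(1) pos by (simp add: y_def)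
      show "(\<Prod>i<k. y i) = M 0 / M k"
        using k' by (simp add: prod_y prod_line Mk)
      show "M 0 / M j \<le> (\<Prod>i<j. y i)" if "j \<le> k" for j
      proof (cases "j \<le> k'")
        case True
        then have "(\<Prod>i<j. y i) = (\<Prod>i<j. x i)" by (intro prod.cong) (auto simp: y_def)
        then show ?thesis using x(3)[OF True] by simp
      next
        case False
        then show ?thesis
          using that spec[OF below, of j] pos M[of 0] M[of j]
          by (simp add: prod_y prod_line divide_left_mono)
      qed
      show "a \<le> u" "u \<le> b" using u t by auto
      show "\<exists>n\<le>k. (1 / 2) ^ k * (2 * \<mu>) ^ n * c \<le> norm (g n u)" by (rule hit)
      show "(\<Sum>i<k. y i) \<le> 4 * (s b - s u)"
        using sum u(4) by (simp add: sum_y)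
    qed
  qed
qed

text \<open>The partial products of the reciprocal slopes dominate \<open>M 0 / M n\<close>, and
  Carleman's inequality bounds the sum of their roots by a multiple of the arc length, uniformly in
  \<open>k\<close>.\<close>

lemma sum_root_le:
  fixes M :: "nat \<Rightarrow> real" and k :: nat
  assumes M: "\<And>n. M n > 0" and bound: "\<forall>n>0. \<forall>u\<in>{a..b}. norm (g n u) \<le> M n"
    and start: "M 0 \<le> norm (g 0 b)" and ab: "a \<le> b"
  shows "(\<Sum>n=1..k. (M 0 / M n) powr (1 / n)) \<le> 8 * exp 1 * (s b - s a)"
proof (cases "k = 0")
  case True
  then show ?thesis using mono ab by simp
next
  case False
  then obtain c \<mu> where line: "c > 0" "\<mu> > 0" "M k = c * \<mu> ^ k" "\<forall>j\<le>k. c * \<mu> ^ j \<le> M j"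
    using tangent_exists[of M k] M by (metis gr0I)
  obtain x t where x: "\<And>i. x i > 0" "\<And>j. j \<le> k \<Longrightarrow> M 0 / M j \<le> (\<Prod>i<j. x i)"
    and t: "a \<le> t" "t \<le> b" and sum: "(\<Sum>i<k. x i) \<le> 4 * (s b - s t)"
    using descent[OF M bound start ab line] by metis
  have "(\<Sum>n=1..k. (M 0 / M n) powr (1 / n)) \<le> (\<Sum>n=1..k. (\<Prod>i<n. x i) powr (1 / n))"
    using x M by (intro sum_mono powr_mono2) (auto simp: less_imp_le)
  also have "\<dots> \<le> 2 * exp 1 * (\<Sum>i<k. x i)"
    by (rule carleman_inequality[OF x(1)])
  also have "\<dots> \<le> 2 * exp 1 * (4 * (s b - s t))"
    using sum by (intro mult_left_mono) auto
  also have "\<dots> \<le> 2 * exp 1 * (4 * (s b - s a))"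
    using mono[of a t] t by (intro mult_left_mono) auto
  also have "\<dots> = 8 * exp 1 * (s b - s a)" by (simp add: algebra_simps)
  finally show ?thesis .
qed

lemma flat_chain_vanishes:
  assumes M: "\<And>n. M n > 0" and bound: "\<And>n u. a \<le> u \<Longrightarrow> u \<le> b \<Longrightarrow> norm (g n u) \<le> M n"
    and div: "filterlim (\<lambda>N. \<Sum>n=1..N. M n powr (- 1 / real n)) at_top sequentially"
    and ab: "a \<le> b"
  shows "g 0 b = 0"
proof (rule ccontr)
  assume nz: "g 0 b \<noteq> 0"
  define m where "m = norm (g 0 b)"
  \<comment> \<open>Lowering the value at 0 to \<open>m\<close> gives \<open>start\<close> with
    equality and leaves the bounds for positive indices unchanged.\<close>
  define M' where "M' = M(0 := m)"
  have m: "m > 0" using nz by (simp add: m_def)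
  have M': "M' n > 0" for n using M m by (simp add: M'_def)
  \<comment> \<open>\<open>q\<close> bounds \<open>m powr (1 / n)\<close> from below for all
    \<open>n \<ge> 1\<close> at once, so it factors out of the sum.\<close>
  define q where "q = min 1 m"
  have q: "q > 0" "q \<le> 1" using m by (auto simp: q_def)
  have root: "q * M n powr (- 1 / n) \<le> (M' 0 / M' n) powr (1 / n)" if "n \<in> {1..N}" for n N
  proof -
    have "q = q powr 1" using q by simp
    also have "\<dots> \<le> q powr (1 / n)" using that q by (intro powr_mono') auto
    also have "\<dots> \<le> m powr (1 / n)" using q by (intro powr_mono2) (auto simp: q_def)
    finally have "q \<le> m powr (1 / n)" .
    then show ?thesis
      using that M[of n] m
      by (simp add: M'_def powr_divide powr_minus divide_simps)
  qed
  have "(\<Sum>n=1..N. M n powr (- 1 / real n)) \<le> 8 * exp 1 * (s b - s a) / q" for N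
  proof -
    have "q * (\<Sum>n=1..N. M n powr (- 1 / real n)) \<le> (\<Sum>n=1..N. (M' 0 / M' n) powr (1 / n))"
      unfolding sum_distrib_left using root by (rule sum_mono)
    also have "\<dots> \<le> 8 * exp 1 * (s b - s a)"
      using M' bound ab by (intro sum_root_le) (auto simp: M'_def m_def)
    finally show ?thesis using q by (simp add: field_simps)
  qed
  moreover obtain N where "8 * exp 1 * (s b - s a) / q < (\<Sum>n=1..N. M n powr (- 1 / real n))"
    using div by (auto simp: filterlim_at_top_dense dest!: spec eventually_happens)
  ultimately show False by (meson not_less)
qed

end

section \<open>Arc length\<close>

definition variation_sum :: "(real \<Rightarrow> complex) \<Rightarrow> real set set \<Rightarrow> real" where
  "variation_sum \<gamma> \<D> = (\<Sum>K\<in>\<D>. norm (\<gamma> (Sup K) - \<gamma> (Inf K)))"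

definition arclen :: "(real \<Rightarrow> complex) \<Rightarrow> real \<Rightarrow> real \<Rightarrow> real" where
  "arclen \<gamma> a t = Sup (variation_sum \<gamma> ` {\<D>. \<D> division_of {a..t}})"

lemma division_of_interval_self: "a \<le> b \<Longrightarrow> {{a..b::real}} division_of {a..b}"
  using division_of_self[of a b] by simp

text \<open>Divisions may contain degenerate intervals, but the only possible common member is
  \<open>{b}\<close>, which contributes 0.\<close>

lemma division_of_union_interval:
  fixes a b c :: real
  assumes D: "D division_of {a..b}" and E: "E division_of {b..c}" and "a \<le> b" "b \<le> c"
  shows "(D \<union> E) division_of {a..c}"
    and "variation_sum \<gamma> (D \<union> E) = variation_sum \<gamma> D + variation_sum \<gamma> E"
proof -
  have "(D \<union> E) division_of ({a..b} \<union> {b..c})"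
    using D E by (rule division_disjoint_union) auto
  moreover have "{a..b} \<union> {b..c} = {a..c}" using assms by auto
  ultimately show "(D \<union> E) division_of {a..c}" by simp
  have "norm (\<gamma> (Sup K) - \<gamma> (Inf K)) = 0" if K: "K \<in> D \<inter> E" for K
  proof -
    have "K \<subseteq> {a..b}" "K \<subseteq> {b..c}" "K \<noteq> {}"
      using K division_ofD(2,3)[OF D] division_ofD(2,3)[OF E] by auto
    then have "K \<subseteq> {b}" by fastforce
    then have "K = {b}" using \<open>K \<noteq> {}\<close> by blast
    then show ?thesis by simp
  qed
  then have "variation_sum \<gamma> (D \<inter> E) = 0"
    unfolding variation_sum_def by (intro sum.neutral) auto
  moreover have "finite D" "finite E" using D E by auto
  ultimately show "variation_sum \<gamma> (D \<union> E) = variation_sum \<gamma> D + variation_sum \<gamma> E"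
    using sum.union_inter[of D E "\<lambda>K. norm (\<gamma> (Sup K) - \<gamma> (Inf K))"]
    by (simp add: variation_sum_def)
qed

lemma variation_sum_nonneg: "variation_sum \<gamma> D \<ge> 0"
  unfolding variation_sum_def by (intro sum_nonneg) auto

text \<open>Adjoining \<open>E\<close> to any division of \<open>{a..c}\<close> gives a division of
  \<open>{a..d}\<close>; the supremum is then taken over the first part.\<close>

lemma arclen_add_le:
  assumes rect: "rectifiable (\<gamma>, a, b)" and "a \<le> c" "c \<le> d" "d \<le> b" and E: "E division_of {c..d}"
  shows "arclen \<gamma> a c + variation_sum \<gamma> E \<le> arclen \<gamma> a d"
proof -
  obtain L where L: "variation_sum \<gamma> D \<le> L" if "D division_of {a..b}" for D
    using rect by (auto simp: variation_sum_def)
  \<comment> \<open>A division of \<open>{a..d}\<close> is completed by \<open>{d..b}\<close>, so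
    rectifiability on \<open>{a..b}\<close> bounds it.\<close>
  have bdd: "bdd_above (variation_sum \<gamma> ` {D. D division_of {a..d}})"
  proof (rule bdd_aboveI2)
    fix D assume "D \<in> {D. D division_of {a..d}}"
    then have D: "D division_of {a..d}" by simp
    note u = division_of_union_interval[OF D division_of_interval_self]
    show "variation_sum \<gamma> D \<le> L"
      using u(2)[of b \<gamma>] L[OF u(1)[of b]] assms variation_sum_nonneg[of \<gamma> "{{d..b}}"] by simp
  qed
  have "arclen \<gamma> a c \<le> arclen \<gamma> a d - variation_sum \<gamma> E"
    unfolding arclen_def[of \<gamma> a c]
  proof (rule cSUP_least)
    show "{D. D division_of {a..c}} \<noteq> {}"
      using division_of_interval_self[OF \<open>a \<le> c\<close>] by auto
    fix D assume "D \<in> {D. D division_of {a..c}}"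
    then have D: "D division_of {a..c}" by simp
    note u = division_of_union_interval[OF D E \<open>a \<le> c\<close> \<open>c \<le> d\<close>]
    have "variation_sum \<gamma> (D \<union> E) \<le> arclen \<gamma> a d"
      unfolding arclen_def using u(1) bdd by (intro cSUP_upper) auto
    then show "variation_sum \<gamma> D \<le> arclen \<gamma> a d - variation_sum \<gamma> E"
      using u(2)[of \<gamma>] by simp
  qed
  then show ?thesis by simp
qed

lemma arclen_mono:
  assumes "rectifiable (\<gamma>, a, b)" "a \<le> c" "c \<le> d" "d \<le> b"
  shows "arclen \<gamma> a c \<le> arclen \<gamma> a d"
  using arclen_add_le[OF assms division_of_interval_self[OF assms(3)]]
    variation_sum_nonneg[of \<gamma> "{{c..d}}"] by linarith

section \<open>Path integrals bounded by arc length\<close>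

text \<open>Ensures that the mesh condition in \<open>has_path_integral\<close> is never vacuous;
  Cousin's lemma is applied to balls of radius \<open>\<delta> / 2\<close>.\<close>

lemma fine_tagged_division_exists:
  fixes a b :: real
  assumes "\<delta> > 0"
  obtains \<D> where "\<D> tagged_division_of {a..b}" "\<forall>(t, K)\<in>\<D>. Sup K - Inf K < \<delta>"
proof -
  have "gauge (\<lambda>x::real. ball x (\<delta> / 2))" using assms by (intro gauge_ball) auto
  then obtain \<D> where D: "\<D> tagged_division_of {a..b}" "(\<lambda>x. ball x (\<delta> / 2)) fine \<D>"
    by (rule fine_division_exists_real)
  have "Sup K - Inf K < \<delta>" if K: "(t, K) \<in> \<D>" for t K
  proof -
    obtain u v where uv: "K = {u..v}" using tagged_division_ofD(4)[OF D(1) K] by auto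
    moreover have "t \<in> K" using tagged_division_ofD(2)[OF D(1) K] .
    ultimately have "u \<le> v" by auto
    moreover have "{u..v} \<subseteq> ball t (\<delta> / 2)" using D(2) K uv by (auto dest: fineD)
    ultimately have "dist t u < \<delta> / 2" "dist t v < \<delta> / 2" by auto
    then have "v - u < \<delta>" unfolding dist_real_def by linarith
    then show ?thesis using uv \<open>u \<le> v\<close> by simp
  qed
  then show ?thesis using D that by blast
qed

text \<open>Every Riemann sum is at most \<open>B\<close> times the variation over its division, and
  a fine one is within \<open>\<epsilon>\<close> of \<open>I\<close>.\<close>

lemma norm_path_integral_le:
  assumes I: "has_path_integral g (\<gamma>, c, d) I" and cd: "c \<le> d"
    and B: "\<And>t. c \<le> t \<Longrightarrow> t \<le> d \<Longrightarrow> norm (g (\<gamma> t)) \<le> B"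
    and V: "\<And>E. E division_of {c..d} \<Longrightarrow> variation_sum \<gamma> E \<le> l"
  shows "norm I \<le> B * l"
proof (rule field_le_epsilon)
  fix \<epsilon> :: real assume "\<epsilon> > 0"
  then have "\<exists>\<delta>>0. \<forall>\<D>. \<D> tagged_division_of {c..d} \<and> (\<forall>(t, K)\<in>\<D>. Sup K - Inf K < \<delta>) \<longrightarrow>
      norm ((\<Sum>(t, K)\<in>\<D>. g (\<gamma> t) * (\<gamma> (Sup K) - \<gamma> (Inf K))) - I) < \<epsilon>"
    using spec[OF I[unfolded has_path_integral.simps], of \<epsilon>] by (rule rev_mp)
  then obtain \<delta> where "\<delta> > 0" and \<delta>: "\<forall>\<D>. \<D> tagged_division_of {c..d} \<and>
      (\<forall>(t, K)\<in>\<D>. Sup K - Inf K < \<delta>) \<longrightarrow>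
      norm ((\<Sum>(t, K)\<in>\<D>. g (\<gamma> t) * (\<gamma> (Sup K) - \<gamma> (Inf K))) - I) < \<epsilon>"
    by (elim exE conjE)
  obtain \<D> where D: "\<D> tagged_division_of {c..d}" "\<forall>(t, K)\<in>\<D>. Sup K - Inf K < \<delta>"
    using fine_tagged_division_exists[OF \<open>\<delta> > 0\<close>] by metis
  define S where "S = (\<Sum>(t, K)\<in>\<D>. g (\<gamma> t) * (\<gamma> (Sup K) - \<gamma> (Inf K)))"
  have "B \<ge> 0" using B[of c] cd norm_ge_zero[of "g (\<gamma> c)"] by linarith
  have "norm S \<le> (\<Sum>(t, K)\<in>\<D>. B * norm (\<gamma> (Sup K) - \<gamma> (Inf K)))"
    unfolding S_def
  proof (rule sum_norm_le, clarify)
    fix t K assume K: "(t, K) \<in> \<D>"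
    then have "t \<in> {c..d}" using tagged_division_ofD(2,3)[OF D(1) K] by blast
    then show "norm (g (\<gamma> t) * (\<gamma> (Sup K) - \<gamma> (Inf K))) \<le> B * norm (\<gamma> (Sup K) - \<gamma> (Inf K))"
      using B[of t] by (simp add: norm_mult mult_right_mono)
  qed
  also have "\<dots> = B * (\<Sum>(t, K)\<in>\<D>. norm (\<gamma> (Sup K) - \<gamma> (Inf K)))"
    by (simp add: sum_distrib_left split_def)
  also have "(\<Sum>(t, K)\<in>\<D>. norm (\<gamma> (Sup K) - \<gamma> (Inf K))) = variation_sum \<gamma> (snd ` \<D>)"
  proof -
    \<comment> \<open>The library lemma also demands the value 0 at the empty interval, where \<open>Sup\<close> and \<open>Inf\<close>
      are unspecified.\<close>
    define v where "v K = (if K = {} then 0 else norm (\<gamma> (Sup K) - \<gamma> (Inf K)))" for K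
    have ne: "K \<noteq> {}" if "(t, K) \<in> \<D>" for t K
      using tagged_division_ofD(2)[OF D(1) that] by auto
    have "(\<Sum>(t, K)\<in>\<D>. v K) = sum v (snd ` \<D>)"
    proof (rule sum.over_tagged_division_lemma[OF D(1)])
      fix x y :: real assume "box x y = {}"
      then have "x \<ge> y" by simp
      then show "v (cbox x y) = 0" by (cases "x = y") (auto simp: v_def)
    qed
    moreover have "(\<Sum>(t, K)\<in>\<D>. v K) = (\<Sum>(t, K)\<in>\<D>. norm (\<gamma> (Sup K) - \<gamma> (Inf K)))"
      using ne by (intro sum.cong) (auto simp: v_def)
    moreover have "sum v (snd ` \<D>) = variation_sum \<gamma> (snd ` \<D>)"
      unfolding variation_sum_def using ne by (intro sum.cong) (auto simp: v_def)
    ultimately show ?thesis by simp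
  qed
  also have "B * variation_sum \<gamma> (snd ` \<D>) \<le> B * l"
    using V[OF division_of_tagged_division[OF D(1)]] \<open>B \<ge> 0\<close> by (rule mult_left_mono)
  finally have "norm S \<le> B * l" .
  moreover have "norm (S - I) < \<epsilon>" using mp[OF spec[OF \<delta>, of \<D>] conjI[OF D]] by (simp only: S_def)
  ultimately show "norm I \<le> B * l + \<epsilon>"
    using norm_triangle_ineq2[of I S] by (simp add: norm_minus_commute)
qed

section \<open>Iterated derivatives along a path\<close>

text \<open>The order \<open>m\<close> is arbitrary because each derivative uses up one
  order.\<close>

lemma F_deriv_n_in_D_space:
  assumes "f \<in> D_infinity F X"
  shows "F_deriv_n F X n f \<in> D_space F X m"
proof (induction n arbitrary: m)
  case 0
  \<comment> \<open>\<open>D_infinity\<close> starts at order 1; order 0 follows from the continuity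
    contained in any higher order.\<close>
  have "f \<in> D_space F X (Suc k)" for k
    using assms by (auto simp: D_infinity_def simp del: D_space.simps)
  then show ?case by (cases m) (auto simp: F_deriv_n_def)
next
  case (Suc n)
  have "F_deriv_n F X (Suc n) f = F_deriv F X (F_deriv_n F X n f)"
    by (simp add: F_deriv_n_def)
  then show ?case using Suc[of "Suc m"] by simp
qed

lemma is_F_derivative_F_deriv_n:
  assumes "f \<in> D_infinity F X"
  shows "is_F_derivative F X (F_deriv_n F X n f) (F_deriv_n F X (Suc n) f)"
proof -
  have "\<exists>h. is_F_derivative F X (F_deriv_n F X n f) h"
    using F_deriv_n_in_D_space[OF assms, of n "Suc 0"] by simp
  then show ?thesis
    by (simp add: F_deriv_n_def F_deriv_def someI_ex)
qed

theorem theorem3p7: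
  fixes \<Gamma> :: "real \<Rightarrow> complex" and a b :: real
    and F :: "cpath set" and X :: "complex set"
    and M :: "nat \<Rightarrow> real" and f :: "complex \<Rightarrow> complex" and z0 :: complex
  assumes "admissible (\<Gamma>, a, b)"
    and "F = subpaths (\<Gamma>, a, b) \<union> reverse_cpath ` subpaths (\<Gamma>, a, b)"
    and "X = image_of (\<Gamma>, a, b)"
    and "\<And>n. M n > 0"
    and "filterlim (\<lambda>N. \<Sum>n=1..N. M n powr (- 1 / real n)) at_top sequentially"
    and "f \<in> D_infinity F X"
    and "z0 \<in> X"
    and "\<And>k. (SUP z\<in>X. norm (F_deriv_n F X k f z)) \<le> M k"
    and "\<And>k. F_deriv_n F X k f z0 = 0"
  shows "\<forall>z\<in>X. f z = 0"
proof
  fix z assume "z \<in> X"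
  define D where "D n = F_deriv_n F X n f" for n
  define s where "s = arclen \<Gamma> a"
  have X: "X = \<Gamma> ` {a..b}" using assms(3) by simp
  have \<Gamma>: "continuous_on {a..b} \<Gamma>" and rect: "rectifiable (\<Gamma>, a, b)"
    using assms(1) by (auto simp: admissible_def)
  have D: "continuous_on X (D n)" for n
    using F_deriv_n_in_D_space[OF assms(6), of n 0] by (simp add: D_def)
  have D\<Gamma>: "continuous_on {a..b} (\<lambda>t. D n (\<Gamma> t))" for n
    using D[of n] \<Gamma> unfolding X by (rule continuous_on_compose2) auto
  have D_le: "norm (D n (\<Gamma> t)) \<le> M n" if "a \<le> t" "t \<le> b" for n t
  proof -
    \<comment> \<open>Compactness bounds the norms, without which the supremum would say nothing
      about single points.\<close>
    have "compact ((\<lambda>z. norm (D n z)) ` X)"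
      using D unfolding X by (intro compact_continuous_image continuous_on_norm \<Gamma>) auto
    then have "norm (D n (\<Gamma> t)) \<le> (SUP z\<in>X. norm (D n z))"
      using that by (intro cSUP_upper bounded_imp_bdd_above compact_imp_bounded) (auto simp: X)
    then show ?thesis using assms(8)[of n] by (simp add: D_def)
  qed
  have s_mono: "s c \<le> s d" if "a \<le> c" "c \<le> d" "d \<le> b" for c d
    unfolding s_def using rect that by (rule arclen_mono)
  have increment: "norm (D n (\<Gamma> d) - D n (\<Gamma> c)) \<le> B * (s d - s c)"
    if cd: "a \<le> c" "c \<le> d" "d \<le> b"
      and B: "\<And>t. c \<le> t \<Longrightarrow> t \<le> d \<Longrightarrow> norm (D (Suc n) (\<Gamma> t)) \<le> B" for n c d B
  proof (cases "c = d")
    case False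
    \<comment> \<open>\<open>F\<close> contains only non-degenerate subpaths, hence the separate
      case \<open>c = d\<close>.\<close>
    then have "(\<Gamma>, c, d) \<in> F" using cd assms(2) by auto
    then have "has_path_integral (D (Suc n)) (\<Gamma>, c, d) (D n (\<Gamma> d) - D n (\<Gamma> c))"
      using is_F_derivative_F_deriv_n[OF assms(6), of n]
      unfolding is_F_derivative_def D_def by (metis end_pt.simps start_pt.simps)
    then show ?thesis
    proof (rule norm_path_integral_le)
      show "variation_sum \<Gamma> E \<le> s d - s c" if "E division_of {c..d}" for E
        using arclen_add_le[OF rect cd that] by (simp add: s_def)
    qed (use cd B in auto)
  qed simp
  obtain t0 where t0: "a \<le> t0" "t0 \<le> b" "\<Gamma> t0 = z0" using assms(7) by (auto simp: X)
  obtain t1 where t1: "a \<le> t1" "t1 \<le> b" "\<Gamma> t1 = z" using \<open>z \<in> X\<close> by (auto simp: X)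
  have D0: "D n (\<Gamma> t0) = 0" for n using assms(9) t0 by (simp add: D_def)
  have "D 0 (\<Gamma> t1) = 0"
  proof (cases "t0 \<le> t1")
    case True
    interpret flat_chain "\<lambda>n t. D n (\<Gamma> t)" s t0 t1
    proof
      show "continuous_on {t0..t1} (\<lambda>t. D n (\<Gamma> t))" for n
        using t0 t1 by (intro continuous_on_subset[OF D\<Gamma>]) auto
    qed (use t0 t1 s_mono increment D0 in auto)
    show ?thesis
      using flat_chain_vanishes[OF assms(4) _ assms(5) True] D_le t0 t1 by auto
  next
    case False
    \<comment> \<open>The path is run backwards from \<open>t0\<close> to \<open>t1\<close>; the two
      signs make \<open>- s (- t)\<close> nondecreasing, with the same length increments.\<close>
    interpret flat_chain "\<lambda>n t. D n (\<Gamma> (- t))" "\<lambda>t. - s (- t)" "- t0" "- t1"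
    proof
      show "continuous_on {- t0..- t1} (\<lambda>t. D n (\<Gamma> (- t)))" for n
        using t0 t1 by (intro continuous_on_compose2[OF D\<Gamma>] continuous_intros) auto
      show "- s (- c) \<le> - s (- d)" if "- t0 \<le> c" "c \<le> d" "d \<le> - t1" for c d
        using s_mono[of "- d" "- c"] that t0 t1 by auto
      show "norm (D n (\<Gamma> (- d)) - D n (\<Gamma> (- c))) \<le> B * (- s (- d) - - s (- c))"
        if cd: "- t0 \<le> c" "c \<le> d" "d \<le> - t1"
          and B: "\<And>t. c \<le> t \<Longrightarrow> t \<le> d \<Longrightarrow> norm (D (Suc n) (\<Gamma> (- t))) \<le> B" for n c d B
      proof -
        have "norm (D (Suc n) (\<Gamma> t)) \<le> B" if "- d \<le> t" "t \<le> - c" for t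
          using B[of "- t"] that by simp
        then have "norm (D n (\<Gamma> (- c)) - D n (\<Gamma> (- d))) \<le> B * (s (- c) - s (- d))"
          using cd t0 t1 by (intro increment) auto
        then show ?thesis by (simp add: norm_minus_commute)
      qed
    qed (use D0 in auto)
    show ?thesis
      using flat_chain_vanishes[OF assms(4) _ assms(5)] D_le t0 t1 False by auto
  qed
  then show "f z = 0" by (simp add: D_def F_deriv_n_def t1)
qed

end
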